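(* Let $n$ be a non-negative integer and let $$\Theta_1(n,1)=\sum_{k=1}^\infty \frac{\psi\left(\frac{2k+2n+5}{4}\right)-\psi\left(\frac{2k+2n+3}{4}\right)}{(2k+1)^2}.$$ Then: (i) if $n=0$: $\Theta_1(0,1)=-4+(1-G)\pi+\frac{\pi^2}{4}\ln 2+\frac74\zeta(3)$; (ii) if $n=1$: $\Theta_1(1,1)=\frac53-(1-G)\pi+(1-\ln 2)\frac{\pi^2}{4}-\frac74\zeta(3)$; (iii) if $n=2$: $\Theta_1(2,1)=-\frac{14}{5}+(1-G)\pi+\left(\ln 2-\frac12\right)\frac{\pi^2}{4}+\frac74\zeta(3)$; (iv) if $n$ is odd and $n\ne 1$: $$\Theta_1(n,1)=3-\frac18\sum_{j=1}^{\frac{n-1}{2}}\frac{(4j+1)(H_{2j-1}-2H_{4j-1})}{j^2(2j+1)^2}-\sum_{j=1}^{\frac{n-1}{2}}\frac{1}{(2j+1)^2(4j+1)}+4\sum_{j=1}^{n}\frac{(-1)^j}{2j+1}-(1-G)\pi+\left(1-\ln 2-\frac12\sum_{j=1}^{\frac{n-1}{2}}\frac{1}{j(2j+1)}\right)\frac{\pi^2}{4}-\frac74\zeta(3);$$ (v) if $n$ is even and $n\ge 4$: $$\Theta_1(n,1)=-\frac{10}{3}-\frac18\sum_{j=1}^{\frac{n-2}{2}}\frac{(4j+3)(H_{2j-1}-2H_{4j-1})}{(j+1)^2(2j+1)^2}-\sum_{j=1}^{\frac{n-2}{2}}\frac{4j^3+j^2-4j-2}{(j+1)^2(2j+1)^2(4j+3)(4j+1)}-4\sum_{j=1}^{n}\frac{(-1)^j}{2j+1}+(1-G)\pi+\left(\ln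 2-\frac12-\frac12\sum_{j=1}^{\frac{n-2}{2}}\frac{1}{(j+1)(2j+1)}\right)\frac{\pi^2}{4}+\frac74\zeta(3).$$
   Context: $\psi=\Gamma'/\Gamma$ is the digamma function, $H_n=\sum_{k=1}^n\frac1k$ the $n$-th harmonic number, $G=\sum_{k=0}^\infty\frac{(-1)^k}{(2k+1)^2}$ is Catalan's constant, $\zeta$ is the Riemann zeta function. *)

theory Defs
  imports "HOL-Analysis.Analysis"
begin

definition catalan :: real where
  "catalan = (\<Sum>k. (-1) ^ k / real (2 * k + 1) ^ 2)"

(* Dirichlet series; this is the Riemann zeta function only for s > 1. *)
definition zeta :: "real \<Rightarrow> real" where
  "zeta s = (\<Sum>k. 1 / real (k + 1) powr s)"

(* The digamma function Gamma'/Gamma is the library's Digamma, i.e. Polygamma 0; see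
   has_field_derivative_Gamma. *)
definition Theta1_term :: "nat \<Rightarrow> nat \<Rightarrow> real" where
  "Theta1_term n k =
     (Digamma (real (2 * k + 2 * n + 5) / 4) - Digamma (real (2 * k + 2 * n + 3) / 4))
       / real (2 * k + 1) ^ 2"

(* The summation index starts at 1. *)
definition Theta1 :: "nat \<Rightarrow> real" where
  "Theta1 n = (\<Sum>k. Theta1_term n (Suc k))"

end

theory Submission
  imports Defs "HOL-Real_Asymp.Real_Asymp"
begin

text \<open>
  Let \<open>L j = (\<Sum>m<j. (-1)^m / (2m+1))\<close>. The functional equation of the digamma function gives
  \<open>\<psi>((2j+3)/4) - \<psi>((2j+1)/4) = (-1)^j (\<pi> - 4 L j)\<close>; the same functional equation turns the sum of the
  series for \<open>n\<close> and \<open>n + 1\<close> into \<open>\<Sum> 4 / ((2k+1)^2 (2k+2n+3))\<close>, which partial fractions evaluate.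
  Everything thus reduces to \<open>n = 0\<close>, that is, to
  \<open>\<Sum> (-1)^k (L k + L (k+1)) / (2k+1)^2 = \<pi>^2 ln 2 / 8\<close>. Here \<open>L k + L (k+1)\<close> is the integral of
  \<open>sin ((2k+1) u) cot u\<close> over \<open>[0, \<pi>/2]\<close>, and \<open>\<Sum> (-1)^k sin ((2k+1) u) / (2k+1)^2 = \<pi> u / 4\<close> there, so
  the value is \<open>\<pi>/4\<close> times the integral of \<open>u cot u\<close>, which is \<open>\<pi> ln 2 / 2\<close>. The interchange of sum and
  integral is elementary: the \<open>K\<close>-th partial sum differs from \<open>u L K\<close> by \<open>O(u / (K cos u))\<close>, and the factor
  \<open>cot u\<close> makes this \<open>O(1/K)\<close> uniformly in \<open>u\<close>.
\<close>

subsection \<open>Oscillatory integrals\<close>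

text \<open>By the second mean value theorem the integral is \<open>g a\<close> and
  \<open>g b\<close> times integrals of \<open>f\<close> over two adjacent subintervals. Each of
  these is a difference of values of \<open>F\<close>, hence at most \<open>2 * M\<close> in size.
  With \<open>F\<close> of size \<open>1/N\<close>, oscillating integrands get O(1/N)
  bounds.\<close>

lemma has_integral_monotone_times_derivative:
  fixes f F g :: "real \<Rightarrow> real"
  assumes "a \<le> b"
    and g: "\<And>x y. a \<le> x \<Longrightarrow> x \<le> y \<Longrightarrow> y \<le> b \<Longrightarrow> g x \<le> g y" and "0 \<le> g a"
    and F: "\<And>x. x \<in> {a..b} \<Longrightarrow> (F has_real_derivative f x) (at x)"
    and M: "\<And>x. x \<in> {a..b} \<Longrightarrow> \<bar>F x\<bar> \<le> M"
  obtains I where "((\<lambda>x. g x * f x) has_integral I) {a..b}" "\<bar>I\<bar> \<le> 4 * M * g b"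
proof -
  have ftc: "(f has_integral (F d - F c)) {c..d}" if "a \<le> c" "c \<le> d" "d \<le> b" for c d
  proof (rule fundamental_theorem_of_calculus)
    fix x assume "x \<in> {c..d}"
    then have "x \<in> {a..b}" using that by auto
    then show "(F has_vector_derivative f x) (at x within {c..d})"
      using F by (auto simp: has_real_derivative_iff_has_vector_derivative[symmetric]
          intro: has_field_derivative_at_within)
  qed fact
  have "f integrable_on {a..b}"
    using ftc[of a b] \<open>a \<le> b\<close> by (auto simp: integrable_on_def)
  then obtain c where c: "c \<in> {a..b}"
    and I: "((\<lambda>x. g x * f x) has_integral (g a * integral {a..c} f + g b * integral {c..b} f)) {a..b}"
    using second_mean_value_theorem_full[of f a b g] \<open>a \<le> b\<close> g by metis
  have "integral {a..c} f = F c - F a" "integral {c..b} f = F b - F c"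
    using ftc[of a c] ftc[of c b] c by (auto intro: integral_unique)
  moreover have "\<bar>F c - F a\<bar> \<le> 2 * M" "\<bar>F b - F c\<bar> \<le> 2 * M"
    using M[of a] M[of b] M[of c] c \<open>a \<le> b\<close> by auto
  moreover have "0 \<le> g b" "g a \<le> g b"
    using g[of a b] \<open>0 \<le> g a\<close> \<open>a \<le> b\<close> by auto
  moreover have "0 \<le> M" using M[of a] \<open>a \<le> b\<close> by force
  ultimately have "\<bar>g a * integral {a..c} f\<bar> \<le> g b * (2 * M)"
    "\<bar>g b * integral {c..b} f\<bar> \<le> g b * (2 * M)"
    using \<open>0 \<le> g a\<close> by (auto simp: abs_mult intro!: mult_mono)
  then have "\<bar>g a * integral {a..c} f + g b * integral {c..b} f\<bar> \<le> 4 * M * g b"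
    by (simp add: algebra_simps)
  with I that show ?thesis by blast
qed

text \<open>The derivative of \<open>u / sin u\<close> has the sign of
  \<open>sin u - u * cos u\<close>, which vanishes at 0 and has derivative
  \<open>u * sin u\<close>.\<close>

lemma x_over_sin_mono:
  fixes x y :: real
  assumes "0 < x" "x \<le> y" "y < pi"
  shows "x / sin x \<le> y / sin y"
proof (rule DERIV_nonneg_imp_nondecreasing[OF \<open>x \<le> y\<close>])
  fix u assume u: "x \<le> u" "u \<le> y"
  then have s: "sin u > 0" using assms by (intro sin_gt_zero) auto
  have "sin 0 - 0 * cos 0 \<le> sin u - u * cos u"
  proof (rule DERIV_nonneg_imp_nondecreasing[where f = "\<lambda>u. sin u - u * cos u"])
    show "0 \<le> u" using u assms by simp
    fix v assume "0 \<le> v" "v \<le> u"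
    then show "\<exists>d. ((\<lambda>u. sin u - u * cos u) has_real_derivative d) (at v) \<and> 0 \<le> d"
      using u assms
      by (intro exI[of _ "v * sin v"]) (auto intro!: derivative_eq_intros mult_nonneg_nonneg sin_ge_zero)
  qed
  then show "\<exists>d. ((\<lambda>u. u / sin u) has_real_derivative d) (at u) \<and> 0 \<le> d"
    using s by (intro exI[of _ "(sin u - u * cos u) / (sin u)\<^sup>2"])
      (auto intro!: derivative_eq_intros simp: power2_eq_square mult.commute)
qed

section \<open>Telescoping trigonometric sums\<close>

text \<open>Product-to-sum formulas make the sum telescope. Dividing by \<open>sin u\<close>
  expresses \<open>cot u\<close> as a sine polynomial plus the remainder
  \<open>cos ((2N+1) u) / sin u\<close>.\<close>

lemma sin_times_sum_sin_even:
  fixes u :: real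
  shows "2 * sin u * (\<Sum>j<N. sin (2 * real (j + 1) * u)) = cos u - cos ((2 * real N + 1) * u)"
proof (induction N)
  case (Suc N)
  have "2 * sin u * sin (2 * real (N + 1) * u)
      = cos ((2 * real N + 1) * u) - cos ((2 * real (Suc N) + 1) * u)"
    using cos_diff_cos[of "(2 * real N + 1) * u" "(2 * real (Suc N) + 1) * u"]
    by (simp add: algebra_simps add_divide_distrib)
  with Suc show ?case by (simp add: distrib_left)
qed simp

text \<open>Adding the identities for \<open>k\<close> and \<open>k + 1\<close> and dividing by
  \<open>2 * sin u\<close> yields \<open>sin ((2k+1) u) * cot u\<close>; this is why two consecutive
  Leibniz sums occur together later.\<close>

lemma sin_times_sum_cos_odd:
  fixes u :: real
  shows "2 * sin u * (\<Sum>m<k. cos ((2 * real m + 1) * u)) = sin (2 * real k * u)"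
proof (induction k)
  case (Suc k)
  have "2 * sin u * cos ((2 * real k + 1) * u) = sin (2 * real (Suc k) * u) - sin (2 * real k * u)"
    using sin_diff_sin[of "2 * real (Suc k) * u" "2 * real k * u"]
    by (simp add: algebra_simps add_divide_distrib)
  with Suc show ?case by (simp add: distrib_left)
qed simp

text \<open>The factor \<open>2 * cos u\<close> turns each sine into the sum of its two even
  neighbours, and the alternating signs telescope.\<close>

lemma cos_times_alternating_sum_sin_odd:
  fixes u :: real
  shows "2 * cos u * (\<Sum>k<K. (-1) ^ k * sin ((2 * real k + 1) * u)) = - ((-1) ^ K) * sin (2 * real K * u)"
proof (induction K)
  case (Suc K)
  have "2 * cos u * sin ((2 * real K + 1) * u) = sin (2 * real (Suc K) * u) + sin (2 * real K * u)"
    using sin_plus_sin[of "2 * real (Suc K) * u" "2 * real K * u"]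
    by (simp add: algebra_simps add_divide_distrib)
  then have "2 * cos u * ((-1) ^ K * sin ((2 * real K + 1) * u))
    = (-1) ^ K * (sin (2 * real (Suc K) * u) + sin (2 * real K * u))"
    by (metis mult.left_commute)
  with Suc show ?case by (simp add: distrib_left)
qed simp

section \<open>The integral of u cot u over [0, pi/2]\<close>

lemma has_integral_x_times_sin_even:
  "((\<lambda>u. u * sin (2 * real (j + 1) * u)) has_integral (pi / 4 * ((-1) ^ j / real (j + 1)))) {0..pi / 2}"
proof -
  define F where "F u = - u * cos (2 * real (j + 1) * u) / (2 * real (j + 1))
    + sin (2 * real (j + 1) * u) / (2 * real (j + 1))\<^sup>2" for u
  have "((\<lambda>u. - u * cos (w * u) / w + sin (w * u) / w\<^sup>2) has_real_derivative u * sin (w * u)) (at u within S)"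
    if "w \<noteq> 0" for w u :: real and S
    using that by (auto intro!: derivative_eq_intros simp: power2_eq_square diff_divide_distrib)
  then have "(F has_real_derivative u * sin (2 * real (j + 1) * u)) (at u within {0..pi/2})" for u
    unfolding F_def by simp
  then have "((\<lambda>u. u * sin (2 * real (j + 1) * u)) has_integral (F (pi / 2) - F 0)) {0..pi / 2}"
    by (intro fundamental_theorem_of_calculus)
      (auto simp: has_real_derivative_iff_has_vector_derivative[symmetric])
  moreover have "2 * real (j + 1) * (pi / 2) = pi * real (j + 1)" by simp
  then have "F (pi / 2) - F 0 = pi / 4 * ((-1) ^ j / real (j + 1))"
    unfolding F_def by (simp only: cos_npi2 sin_npi2) (simp add: field_simps)
  ultimately show ?thesis by simp
qed

text \<open>Multiplying the finite expansion of \<open>cot u\<close> by \<open>u\<close> and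
  integrating gives \<open>pi / 2\<close> times a partial sum of the alternating harmonic series,
  plus a remainder. The remainder has the increasing weight \<open>u / sin u\<close> against
  \<open>cos ((2N+1) u)\<close>, so it is O(1/N).\<close>

lemma has_integral_x_cot: "((\<lambda>u. u * cot u) has_integral (pi / 2 * ln 2)) {0..pi / 2}"
proof -
  have "\<exists>I. \<bar>I\<bar> \<le> 2 * pi / real (Suc N) \<and>
      ((\<lambda>u. u * cot u) has_integral (pi / 2 * (\<Sum>j<N. (-1) ^ j / real (Suc j)) + I)) {0..pi / 2}" for N
  proof -
    have w: "2 * real N + 1 \<noteq> 0" by linarith
    let ?F = "\<lambda>u. sin ((2 * real N + 1) * u) / (2 * real N + 1)"
    obtain I where I: "((\<lambda>u. u / sin u * cos ((2 * real N + 1) * u)) has_integral I) {0..pi / 2}"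
      and bound: "\<bar>I\<bar> \<le> 4 * (1 / (2 * real N + 1)) * (pi / 2 / sin (pi / 2))"
    proof (rule has_integral_monotone_times_derivative
        [of 0 "pi / 2" "\<lambda>u. u / sin u" ?F "\<lambda>u. cos ((2 * real N + 1) * u)" "1 / (2 * real N + 1)"])
      fix x y :: real assume xy: "0 \<le> x" "x \<le> y" "y \<le> pi / 2"
      \<comment> \<open>monotone also at \<open>0\<close>, since \<open>0 / sin 0 = 0\<close>\<close>
      show "x / sin x \<le> y / sin y"
      proof (cases "x = 0")
        case True
        then show ?thesis using xy by (auto intro!: divide_nonneg_nonneg sin_ge_zero)
      next
        case False
        then show ?thesis using xy pi_gt_zero by (intro x_over_sin_mono) linarith+
      qed
    next
      fix u :: real
      show "(?F has_real_derivative cos ((2 * real N + 1) * u)) (at u)"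
        using w by (auto intro!: derivative_eq_intros)
      show "\<bar>?F u\<bar> \<le> 1 / (2 * real N + 1)"
        by (simp add: abs_div_pos[symmetric] divide_right_mono)
    qed auto
    have "((\<lambda>u. (\<Sum>j<N. 2 * (u * sin (2 * real (j + 1) * u))) + u / sin u * cos ((2 * real N + 1) * u))
        has_integral ((\<Sum>j<N. 2 * (pi / 4 * ((-1) ^ j / real (j + 1)))) + I)) {0..pi / 2}"
      by (intro has_integral_add has_integral_sum has_integral_mult_right
          has_integral_x_times_sin_even I) auto
    moreover have "(\<Sum>j<N. 2 * (u * sin (2 * real (j + 1) * u))) + u / sin u * cos ((2 * real N + 1) * u)
        = u * cot u" if "u \<in> {0..pi / 2}" for u
    proof (cases "u = 0")
      case False
      then have s: "sin u > 0" using that pi_gt_zero by (intro sin_gt_zero) simp_all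
      have "2 * (\<Sum>j<N. sin (2 * real (j + 1) * u)) = (cos u - cos ((2 * real N + 1) * u)) / sin u"
        using sin_times_sum_sin_even[of u N] s by (simp add: field_simps)
      then have "(\<Sum>j<N. 2 * (u * sin (2 * real (j + 1) * u))) = u * ((cos u - cos ((2 * real N + 1) * u)) / sin u)"
        by (simp add: sum_distrib_left[symmetric] mult.left_commute)
      then show ?thesis using s by (simp add: cot_def field_simps)
    qed simp
    ultimately have "((\<lambda>u. u * cot u)
        has_integral ((\<Sum>j<N. 2 * (pi / 4 * ((-1) ^ j / real (j + 1)))) + I)) {0..pi / 2}"
      by (metis (no_types, lifting) has_integral_cong)
    moreover have "(\<Sum>j<N. 2 * (pi / 4 * ((-1) ^ j / real (j + 1)))) = pi / 2 * (\<Sum>j<N. (-1) ^ j / real (Suc j))"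
      unfolding sum_distrib_left by (rule sum.cong) (simp_all add: divide_simps)
    moreover have "4 * (1 / (2 * real N + 1)) * (pi / 2 / sin (pi / 2)) \<le> 2 * pi / real (Suc N)"
      by (simp add: divide_simps)
    ultimately show ?thesis using bound by (metis (no_types, lifting) order_trans)
  qed
  then obtain I where I: "\<And>N. \<bar>I N\<bar> \<le> 2 * pi / real (Suc N)"
    and *: "\<And>N. ((\<lambda>u. u * cot u) has_integral (pi / 2 * (\<Sum>j<N. (-1) ^ j / real (Suc j)) + I N)) {0..pi / 2}"
    by metis
  have "(\<lambda>N. 2 * pi / real (Suc N)) \<longlonglongrightarrow> 0"
    by (intro LIMSEQ_Suc lim_const_over_n)
  then have "I \<longlonglongrightarrow> 0"
    by (rule Lim_null_comparison[rotated]) (simp add: I del: of_nat_Suc)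
  moreover have "(\<lambda>N. \<Sum>j<N. (-1) ^ j / real (Suc j)) \<longlonglongrightarrow> ln 2"
    using alternating_harmonic_series_sums unfolding sums_def by simp
  ultimately have "(\<lambda>N. pi / 2 * (\<Sum>j<N. (-1) ^ j / real (Suc j)) + I N) \<longlonglongrightarrow> pi / 2 * ln 2 + 0"
    by (intro tendsto_intros)
  \<comment> \<open>The integral does not depend on \<open>N\<close>, so this sequence is constant
    and its limit is its value.\<close>
  moreover have "(\<lambda>N. pi / 2 * (\<Sum>j<N. (-1) ^ j / real (Suc j)) + I N) = (\<lambda>_. integral {0..pi / 2} (\<lambda>u. u * cot u))"
    using * by (metis integral_unique)
  ultimately have "integral {0..pi / 2} (\<lambda>u. u * cot u) = pi / 2 * ln 2"
    by (simp add: LIMSEQ_const_iff)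
  then show ?thesis using *[of 0] by (metis integral_unique)
qed

subsection \<open>An alternating Euler sum\<close>

definition leibniz_sum :: "nat \<Rightarrow> real" where
  "leibniz_sum n = (\<Sum>m<n. (-1) ^ m / (2 * real m + 1))"

lemma leibniz_sum_tendsto: "leibniz_sum \<longlonglongrightarrow> pi / 4"
proof -
  have "summable (\<lambda>k. (-1) ^ k * 1 / real (k * 2 + 1))"
    using summable_arctan_series[of 1] by simp
  then have "(\<lambda>k. (-1) ^ k / (2 * real k + 1)) sums (pi / 4)"
    by (simp add: sums_iff pi_series mult.commute add.commute)
  then show ?thesis by (simp add: sums_def leibniz_sum_def[abs_def])
qed

text \<open>The slope of the sine sum at 0 is \<open>leibniz_sum K\<close>, so the difference
  \<open>g\<close> and its derivative \<open>h\<close> both vanish at 0. The derivative of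
  \<open>h\<close> is \<open>(-1)^K * sin (2Kx) / (2 * cos x)\<close>, which oscillates with an
  increasing weight; hence \<open>h\<close> is at most \<open>1 / (K * cos u)\<close> in size, and
  the mean value theorem supplies the factor \<open>u\<close>.\<close>

lemma alternating_sin_sum_linear_approx:
  assumes "0 \<le> u" "u < pi / 2" "K > 0"
  shows "\<bar>(\<Sum>k<K. (-1) ^ k * sin ((2 * real k + 1) * u) / (2 * real k + 1)\<^sup>2) - leibniz_sum K * u\<bar>
    \<le> u / (real K * cos u)"
proof -
  define g where "g u = (\<Sum>k<K. (-1) ^ k * sin ((2 * real k + 1) * u) / (2 * real k + 1)\<^sup>2) - leibniz_sum K * u" for u
  define h where "h u = (\<Sum>k<K. (-1) ^ k * cos ((2 * real k + 1) * u) / (2 * real k + 1)) - leibniz_sum K" for u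
  have nz: "2 * real k + 1 \<noteq> 0" for k by linarith
  have dsin: "((\<lambda>x. e * sin (w * x) / w\<^sup>2) has_real_derivative e * cos (w * x) / w) (at x within S)"
    and dcos: "((\<lambda>x. e * cos (w * x) / w) has_real_derivative - (e * sin (w * x))) (at x within S)"
    if "w \<noteq> 0" for e w x :: real and S
    using that by (auto intro!: derivative_eq_intros simp: power2_eq_square)
  have dg: "(g has_real_derivative h x) (at x within {0..u})" for x
    unfolding g_def h_def
    by (rule derivative_eq_intros dsin nz refl | simp)+
  have dh: "(h has_real_derivative (- (\<Sum>k<K. (-1) ^ k * sin ((2 * real k + 1) * x)))) (at x within S)" for x S
    unfolding h_def sum_negf[symmetric]
    by (rule derivative_eq_intros dcos nz refl | simp)+
  have h0: "h 0 = 0" "g 0 = 0" by (simp_all add: h_def g_def leibniz_sum_def)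
  have cpos: "cos x > 0" if "0 \<le> x" "x \<le> u" for x
    using that assms pi_gt_zero by (intro cos_gt_zero_pi) linarith+
  have "\<bar>h t\<bar> \<le> 1 / (real K * cos u)" if t: "0 \<le> t" "t \<le> u" for t
  proof -
    obtain I where I: "((\<lambda>x. 1 / (2 * cos x) * ((-1) ^ K * sin (2 * real K * x))) has_integral I) {0..t}"
      and bound: "\<bar>I\<bar> \<le> 4 * (1 / (2 * real K)) * (1 / (2 * cos t))"
    proof (rule has_integral_monotone_times_derivative
        [of 0 t "\<lambda>x. 1 / (2 * cos x)" "\<lambda>x. - ((-1) ^ K) * cos (2 * real K * x) / (2 * real K)"
          "\<lambda>x. (-1) ^ K * sin (2 * real K * x)" "1 / (2 * real K)"])
      fix x y :: real assume xy: "0 \<le> x" "x \<le> y" "y \<le> t"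
      then have "cos y \<le> cos x" using t assms pi_gt_zero by (intro cos_monotone_0_pi_le) linarith+
      then show "1 / (2 * cos x) \<le> 1 / (2 * cos y)"
        using cpos[of x] cpos[of y] xy t by (simp add: frac_le)
    next
      fix x :: real
      show "((\<lambda>x. - ((-1) ^ K) * cos (2 * real K * x) / (2 * real K)) has_real_derivative
          (-1) ^ K * sin (2 * real K * x)) (at x)"
        using \<open>K > 0\<close> by (auto intro!: derivative_eq_intros)
      show "\<bar>- ((-1) ^ K) * cos (2 * real K * x) / (2 * real K)\<bar> \<le> 1 / (2 * real K)"
        by (simp add: abs_mult divide_right_mono)
    qed (use t in auto)
    have "((\<lambda>x. - (\<Sum>k<K. (-1) ^ k * sin ((2 * real k + 1) * x))) has_integral (h t - h 0)) {0..t}"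
      using t dh by (intro fundamental_theorem_of_calculus)
        (auto simp: has_real_derivative_iff_has_vector_derivative[symmetric])
    moreover have "- (\<Sum>k<K. (-1) ^ k * sin ((2 * real k + 1) * x)) = 1 / (2 * cos x) * ((-1) ^ K * sin (2 * real K * x))"
      if "x \<in> {0..t}" for x
      using cos_times_alternating_sum_sin_odd[of x K] cpos[of x] that t by (simp add: field_simps)
    ultimately have "((\<lambda>x. 1 / (2 * cos x) * ((-1) ^ K * sin (2 * real K * x))) has_integral (h t - h 0)) {0..t}"
      by (metis (no_types, lifting) has_integral_cong)
    then have "h t = I" using has_integral_unique[OF I] h0 by simp
    moreover have "cos u \<le> cos t" using t assms pi_gt_zero by (intro cos_monotone_0_pi_le) linarith+
    then have "1 / (real K * cos t) \<le> 1 / (real K * cos u)"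
      using cpos[of u] assms by (intro divide_left_mono mult_left_mono mult_pos_pos) auto
    ultimately show ?thesis using bound by simp
  qed
  then have "norm (g u - g 0) \<le> 1 / (real K * cos u) * norm (u - 0)"
    using dg assms by (intro field_differentiable_bound[of "{0..u}" g h]) auto
  then show ?thesis using assms h0 by (simp add: g_def)
qed

lemma has_integral_sum_cos_odd:
  "((\<lambda>u. \<Sum>m<k. cos ((2 * real m + 1) * u)) has_integral leibniz_sum k) {0..pi / 2}"
  unfolding leibniz_sum_def
proof (rule has_integral_sum)
  fix m
  let ?F = "\<lambda>u. sin ((2 * real m + 1) * u) / (2 * real m + 1)"
  have "2 * real m + 1 \<noteq> 0" by linarith
  then have "((\<lambda>u. cos ((2 * real m + 1) * u)) has_integral (?F (pi / 2) - ?F 0)) {0..pi / 2}"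
    by (intro fundamental_theorem_of_calculus)
      (auto simp: has_real_derivative_iff_has_vector_derivative[symmetric] intro!: derivative_eq_intros)
  moreover have "sin ((2 * real m + 1) * (pi / 2)) = (-1) ^ m"
  proof -
    have "(2 * real m + 1) * (pi / 2) = real m * pi + pi / 2" by (simp add: algebra_simps)
    then show ?thesis by (simp only: sin_add cos_npi) simp
  qed
  ultimately show "((\<lambda>u. cos ((2 * real m + 1) * u)) has_integral ((-1) ^ m / (2 * real m + 1))) {0..pi / 2}"
    by simp
qed simp

text \<open>Each partial sum \<open>A K\<close> is an integral of cosine sums. Replacing the sine
  polynomial in the integrand by \<open>leibniz_sum K * u\<close> costs at most
  \<open>pi / 2 / K\<close> at each interior point, so \<open>A K\<close> has the same limit as
  \<open>leibniz_sum K\<close> times the integral of \<open>u * cot u\<close>.\<close>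

lemma alternating_leibniz_sums:
  "(\<lambda>k. (-1) ^ k * (leibniz_sum k + leibniz_sum (Suc k)) / (2 * real k + 1)\<^sup>2) sums (pi\<^sup>2 / 8 * ln 2)"
proof -
  define c where "c k u = (\<Sum>m<k. cos ((2 * real m + 1) * u))" for k u
  define A where "A K = (\<Sum>k<K. (-1) ^ k * (leibniz_sum k + leibniz_sum (Suc k)) / (2 * real k + 1)\<^sup>2)" for K
  have "\<bar>A K - leibniz_sum K * (pi / 2 * ln 2)\<bar> \<le> pi\<^sup>2 / 4 / real K" if "K > 0" for K
  proof -
    have "((\<lambda>u. (\<Sum>k<K. (-1) ^ k / (2 * real k + 1)\<^sup>2 * (c k u + c (Suc k) u)) - leibniz_sum K * (u * cot u))
      has_integral ((\<Sum>k<K. (-1) ^ k / (2 * real k + 1)\<^sup>2 * (leibniz_sum k + leibniz_sum (Suc k)))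
         - leibniz_sum K * (pi / 2 * ln 2))) {0..pi / 2}" (is "(?H has_integral _) _")
      unfolding c_def
      by (intro has_integral_diff has_integral_add has_integral_sum has_integral_mult_right
          has_integral_sum_cos_odd has_integral_x_cot) auto
    then have H: "(?H has_integral (A K - leibniz_sum K * (pi / 2 * ln 2))) {0..pi / 2}"
      by (simp add: A_def)
    have "norm (A K - leibniz_sum K * (pi / 2 * ln 2)) \<le> (pi / 2 / real K) * measure lborel {0..pi / 2}"
    \<comment> \<open>The two endpoints form a negligible set; leaving them out makes both
      \<open>sin u\<close> and \<open>cos u\<close> positive.\<close>
    proof (rule has_integral_bound_real[OF _ _ H, of _ "{0, pi / 2}"])
      fix u assume "u \<in> {0..pi / 2} - {0, pi / 2}"
      then have u: "0 < u" "u < pi / 2" by auto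
      then have s: "sin u > 0" and co: "cos u > 0"
        using pi_gt_zero by (auto intro!: sin_gt_zero cos_gt_zero_pi)
      have cc: "c k u + c (Suc k) u = sin ((2 * real k + 1) * u) * cot u" for k
      proof -
        have "2 * sin u * (c k u + c (Suc k) u) = sin (2 * real k * u) + sin (2 * real (Suc k) * u)"
          unfolding c_def distrib_left sin_times_sum_cos_odd ..
        also have "\<dots> = 2 * sin ((2 * real k + 1) * u) * cos u"
          using sin_plus_sin[of "2 * real (Suc k) * u" "2 * real k * u"]
          by (simp add: algebra_simps add_divide_distrib)
        finally show ?thesis using s by (simp add: cot_def field_simps)
      qed
      have "?H u = ((\<Sum>k<K. (-1) ^ k * sin ((2 * real k + 1) * u) / (2 * real k + 1)\<^sup>2) - leibniz_sum K * u) * cot u"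
        unfolding cc by (simp add: sum_distrib_right left_diff_distrib mult.assoc)
      then have "norm (?H u) = \<bar>(\<Sum>k<K. (-1) ^ k * sin ((2 * real k + 1) * u) / (2 * real k + 1)\<^sup>2) - leibniz_sum K * u\<bar> * cot u"
        using s co by (simp only: real_norm_def abs_mult) (simp add: cot_def)
      \<comment> \<open>The \<open>cos u\<close> in the error bound cancels against the numerator of
        \<open>cot u\<close>, leaving \<open>u / sin u\<close>, which is largest at
        \<open>pi / 2\<close>.\<close>
      also have "\<dots> \<le> u / (real K * cos u) * cot u"
        using alternating_sin_sum_linear_approx[of u K] u that s co
        by (intro mult_right_mono) (simp_all add: cot_def)
      also have "\<dots> = u / sin u / real K"
        using s co by (simp add: cot_def)
      also have "\<dots> \<le> (pi / 2) / sin (pi / 2) / real K"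
        using u pi_gt_zero by (intro divide_right_mono x_over_sin_mono) linarith+
      finally show "norm (?H u) \<le> pi / 2 / real K" by simp
    qed auto
    then show ?thesis by (simp add: power2_eq_square)
  qed
  then have "(\<lambda>K. A K - leibniz_sum K * (pi / 2 * ln 2)) \<longlonglongrightarrow> 0"
    by (intro Lim_null_comparison[OF _ lim_const_over_n[of "pi\<^sup>2 / 4"]])
      (auto simp: eventually_sequentially intro!: exI[of _ 1])
  moreover have "(\<lambda>K. leibniz_sum K * (pi / 2 * ln 2)) \<longlonglongrightarrow> pi / 4 * (pi / 2 * ln 2)"
    by (intro tendsto_intros leibniz_sum_tendsto)
  ultimately have "(\<lambda>K. A K - leibniz_sum K * (pi / 2 * ln 2) + leibniz_sum K * (pi / 2 * ln 2))
      \<longlonglongrightarrow> 0 + pi / 4 * (pi / 2 * ln 2)"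
    by (rule tendsto_add)
  then show ?thesis by (simp add: sums_def A_def power2_eq_square mult.assoc)
qed

subsection \<open>Series over the odd numbers\<close>

text \<open>Group the full series into pairs of one odd and one even denominator, then subtract the
  even part, which is the full series divided by \<open>2 ^ p\<close>.\<close>

lemma odd_inverse_powers_sums:
  assumes "(\<lambda>k. 1 / real (k + 1) ^ p) sums s"
  shows "(\<lambda>k. 1 / (2 * real k + 1) ^ p) sums (s - s / 2 ^ p)"
proof -
  have "(\<lambda>n. \<Sum>k=n*2..<n*2+2. 1 / real (k + 1) ^ p) sums s"
    using sums_group[OF assms, of 2] by simp
  then have "(\<lambda>n. 1 / (2 * real n + 1) ^ p + 1 / (2 * real n + 2) ^ p) sums s"
    by (simp add: numeral_2_eq_2 sum.atLeastLessThan_Suc algebra_simps)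
  moreover have "(\<lambda>n. 1 / 2 ^ p * (1 / real (n + 1) ^ p)) sums (1 / 2 ^ p * s)"
    by (intro sums_mult assms)
  then have "(\<lambda>n. 1 / (2 * real n + 2) ^ p) sums (s / 2 ^ p)"
    by (simp add: power_mult_distrib[symmetric] algebra_simps)
  ultimately have "(\<lambda>n. (1 / (2 * real n + 1) ^ p + 1 / (2 * real n + 2) ^ p) - 1 / (2 * real n + 2) ^ p) sums (s - s / 2 ^ p)"
    by (rule sums_diff)
  then show ?thesis by simp
qed

lemma odd_inverse_squares_sums: "(\<lambda>k. 1 / (2 * real k + 1)\<^sup>2) sums (pi\<^sup>2 / 8)"
proof -
  have "(\<lambda>k. 1 / real (k + 1) ^ 2) sums (pi\<^sup>2 / 6)"
    using inverse_squares_sums by (simp add: add.commute)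
  from odd_inverse_powers_sums[OF this] show ?thesis by simp
qed

lemma odd_inverse_cubes_sums: "(\<lambda>k. 1 / (2 * real k + 1) ^ 3) sums (7 / 8 * zeta 3)"
proof -
  have "summable (\<lambda>k. inverse (real k ^ 3))"
    by (rule inverse_power_summable) simp
  then have "summable (\<lambda>k. 1 / real (k + 1) ^ 3)"
    by (subst (asm) summable_Suc_iff[symmetric]) (simp add: inverse_eq_divide)
  moreover have "zeta 3 = (\<Sum>k. 1 / real (k + 1) ^ 3)"
    unfolding zeta_def by (intro suminf_cong) simp
  ultimately have "(\<lambda>k. 1 / real (k + 1) ^ 3) sums zeta 3"
    by (simp add: sums_iff)
  from odd_inverse_powers_sums[OF this] show ?thesis by simp
qed

lemma catalan_sums: "(\<lambda>k. (-1) ^ k / (2 * real k + 1)\<^sup>2) sums catalan"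
proof -
  have "summable (\<lambda>k. (-1) ^ k / (2 * real k + 1)\<^sup>2)"
    by (rule summable_norm_cancel)
      (use odd_inverse_squares_sums in \<open>simp add: sums_iff norm_divide norm_power abs_mult power_abs\<close>)
  then show ?thesis by (simp add: sums_iff catalan_def add.commute)
qed

definition odd_harm :: "nat \<Rightarrow> real" where
  "odd_harm a = (\<Sum>i<a. 1 / (2 * real i + 1))"

lemma odd_harm_Suc: "odd_harm (Suc a) = odd_harm a + 1 / (2 * real a + 1)"
  by (simp add: odd_harm_def)

lemma odd_harm_conv_harm: "odd_harm a = harm (2 * a) - harm a / 2"
proof (induction a)
  case (Suc a)
  have "1 / (2 * real a + 2) = 1 / (real a + 1) / 2"
    by (simp add: field_simps)
  then show ?case
    using Suc by (simp add: odd_harm_Suc harm_Suc inverse_eq_divide add_divide_distrib add.commute)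
qed (simp add: odd_harm_def harm_def)

text \<open>Splitting off the last terms of \<open>harm (4 * j)\<close> and
  \<open>harm (2 * j) / 2\<close> removes \<open>1 / (4 * j)\<close> from both, and these cancel.
  This produces the indices \<open>4 * j - 1\<close> and \<open>2 * j - 1\<close> of the closed
  forms.\<close>

lemma odd_harm_even:
  assumes "j > 0"
  shows "odd_harm (2 * j) = - (harm (2 * j - 1) - 2 * harm (4 * j - 1)) / 2"
proof -
  have "(harm m :: real) = harm (m - 1) + 1 / real m" if "m > 0" for m
    using that by (cases m) (simp_all add: harm_Suc inverse_eq_divide)
  from this[of "4 * j"] this[of "2 * j"] assms
  have "(harm (4 * j) :: real) = harm (4 * j - 1) + 1 / (4 * real j)"
    "(harm (2 * j) :: real) = harm (2 * j - 1) + 2 * (1 / (4 * real j))"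
    by simp_all
  then have "(harm (4 * j) :: real) - harm (2 * j) / 2 = - (harm (2 * j - 1) - 2 * harm (4 * j - 1)) / 2"
    by argo
  then show ?thesis
    unfolding odd_harm_conv_harm by simp
qed

text \<open>Raising \<open>a\<close> by one adds a series of consecutive differences, which
  telescopes to \<open>1 / (2 * a + 1)\<close>.\<close>

lemma telescoping_odd_sums: "(\<lambda>k. 1 / (2 * real k + 1) - 1 / (2 * real k + 1 + 2 * real a)) sums odd_harm a"
proof (induction a)
  case (Suc a)
  have "(\<lambda>k. 1 / (2 * real k + 1 + 2 * real a)) \<longlonglongrightarrow> 0"
    by real_asymp
  from telescope_sums'[OF this]
  have "(\<lambda>k. 1 / (2 * real k + 1 + 2 * real a) - 1 / (2 * real k + 1 + 2 * real (Suc a))) sums (1 / (2 * real a + 1))"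
    by (simp add: algebra_simps)
  from sums_add[OF Suc this] show ?case by (simp add: odd_harm_Suc)
qed (simp add: odd_harm_def)

text \<open>The value of the series of \<open>4 / ((2k+1)^2 (2k+1+2a))\<close> for
  \<open>a > 0\<close>; its \<open>pi\<close> term comes from the odd inverse squares.\<close>

definition rational_part :: "nat \<Rightarrow> real" where
  "rational_part a = pi\<^sup>2 / (4 * real a) - odd_harm a / (real a)\<^sup>2"

lemma rational_part_sums:
  assumes "a > 0"
  shows "(\<lambda>k. 4 / ((2 * real k + 1)\<^sup>2 * (2 * real k + 1 + 2 * real a))) sums rational_part a"
proof -
  \<comment> \<open>Partial fractions in \<open>q = 2k+1\<close>: a multiple of the odd inverse
    squares minus a multiple of the telescoping series.\<close>
  have pf: "4 / (q\<^sup>2 * (q + 2 * x)) = 2 / x * (1 / q\<^sup>2) - 1 / x\<^sup>2 * (1 / q - 1 / (q + 2 * x))"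
    if "q > 0" "x > 0" for q x :: real
  proof -
    have "q + 2 * x \<noteq> 0" using that by linarith
    then show ?thesis using that by (simp add: divide_simps) (simp add: power2_eq_square algebra_simps)
  qed
  have "(\<lambda>k. 2 / real a * (1 / (2 * real k + 1)\<^sup>2)
      - 1 / (real a)\<^sup>2 * (1 / (2 * real k + 1) - 1 / (2 * real k + 1 + 2 * real a)))
      sums (2 / real a * (pi\<^sup>2 / 8) - 1 / (real a)\<^sup>2 * odd_harm a)"
    by (intro sums_diff sums_mult odd_inverse_squares_sums telescoping_odd_sums)
  then show ?thesis
    using assms by (simp add: pf rational_part_def)
qed

subsection \<open>The digamma series\<close>

text \<open>The numerator of \<open>Theta1_term n k\<close> depends only on \<open>k + n\<close>; it
  is this gap at \<open>j = k + n + 1\<close>.\<close>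

definition digamma_gap :: "nat \<Rightarrow> real" where
  "digamma_gap j = Digamma ((2 * real j + 3) / 4) - Digamma ((2 * real j + 1) / 4)"

text \<open>The value at \<open>(2j+3)/4\<close> cancels between the two gaps, leaving a difference
  of digamma values at arguments one apart.\<close>

lemma digamma_gap_Suc: "digamma_gap j + digamma_gap (Suc j) = 4 / (2 * real j + 1)"
proof -
  have "Digamma ((2 * real j + 1) / 4 + 1) = Digamma ((2 * real j + 1) / 4) + 1 / ((2 * real j + 1) / 4)"
    by (rule Digamma_plus1) (simp add: add_nonneg_eq_0_iff)
  moreover have "(2 * real j + 1) / 4 + 1 = (2 * real (Suc j) + 3) / 4"
    by (simp add: field_simps)
  moreover have "(2 * real (Suc j) + 1) / 4 = (2 * real j + 3) / 4"
    by simp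
  ultimately show ?thesis unfolding digamma_gap_def by (simp only:) simp
qed

lemma digamma_gap_nonneg: "0 \<le> digamma_gap j"
  unfolding digamma_gap_def using Digamma_real_mono[of "(2 * real j + 1) / 4" "(2 * real j + 3) / 4"] by simp

text \<open>Both gaps in the recursion are nonnegative, so each is at most their sum
  \<open>4 / (2j+1)\<close>.\<close>

lemma digamma_gap_tendsto_0: "digamma_gap \<longlonglongrightarrow> 0"
proof (rule tendsto_sandwich[where f = "\<lambda>_. 0" and h = "\<lambda>j. 4 / (2 * real j + 1)"])
  show "(\<lambda>j. 4 / (2 * real j + 1)) \<longlonglongrightarrow> 0" by real_asymp
  show "\<forall>\<^sub>F j in sequentially. digamma_gap j \<le> 4 / (2 * real j + 1)"
  proof (intro always_eventually allI)
    fix j show "digamma_gap j \<le> 4 / (2 * real j + 1)"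
      using digamma_gap_Suc[of j] digamma_gap_nonneg[of "Suc j"] by linarith
  qed
qed (simp_all add: digamma_gap_nonneg)

text \<open>Multiplying the recursion by signs and summing expresses every gap through
  \<open>digamma_gap 0\<close>. Since the gaps tend to 0, that initial value must be four times the
  limit of the Leibniz sums, namely \<open>pi\<close>.\<close>

lemma digamma_gap_eq: "digamma_gap j = (-1) ^ j * (pi - 4 * leibniz_sum j)"
proof -
  have *: "(-1) ^ j * digamma_gap j = digamma_gap 0 - 4 * leibniz_sum j" for j
  proof (induction j)
    case (Suc j)
    have "digamma_gap (Suc j) = 4 / (2 * real j + 1) - digamma_gap j"
      using digamma_gap_Suc[of j] by linarith
    then have "(-1) ^ Suc j * digamma_gap (Suc j) = (-1) ^ j * digamma_gap j - 4 * ((-1) ^ j / (2 * real j + 1))"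
      by (simp add: right_diff_distrib)
    with Suc show ?case by (simp add: leibniz_sum_def)
  qed (simp add: leibniz_sum_def)
  have "(\<lambda>j. (-1) ^ j * digamma_gap j) \<longlonglongrightarrow> 0"
    by (rule Lim_null_comparison[OF _ digamma_gap_tendsto_0])
      (simp add: abs_mult power_abs digamma_gap_nonneg)
  moreover have "(\<lambda>j. digamma_gap 0 - 4 * leibniz_sum j) \<longlonglongrightarrow> digamma_gap 0 - 4 * (pi / 4)"
    by (intro tendsto_intros leibniz_sum_tendsto)
  ultimately have "digamma_gap 0 = pi"
    unfolding * using LIMSEQ_unique by fastforce
  then have "(-1) ^ j * ((-1) ^ j * digamma_gap j) = (-1) ^ j * (pi - 4 * leibniz_sum j)"
    using *[of j] by simp
  then show ?thesis by (simp add: mult.assoc[symmetric] power_mult_distrib[symmetric])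
qed

section \<open>The case n = 0 and the recursion in n\<close>

lemma Theta1_term_eq: "Theta1_term n k = digamma_gap (k + n + 1) / (2 * real k + 1)\<^sup>2"
  by (simp add: Theta1_term_def digamma_gap_def algebra_simps)

text \<open>
  From here on the series start at \<open>k = 0\<close>, one term earlier than in \<open>Theta1\<close>; this makes the
  recursion in \<open>n\<close> simpler.
\<close>

lemma Theta1_term_sums_0:
  "Theta1_term 0 sums (- pi * catalan + pi\<^sup>2 / 4 * ln 2 + 7 / 4 * zeta 3)"
proof -
  have "(\<lambda>k. - pi * ((-1) ^ k / (2 * real k + 1)\<^sup>2)
      + 2 * ((-1) ^ k * (leibniz_sum k + leibniz_sum (Suc k)) / (2 * real k + 1)\<^sup>2)
      + 2 * (1 / (2 * real k + 1) ^ 3))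
    sums (- pi * catalan + 2 * (pi\<^sup>2 / 8 * ln 2) + 2 * (7 / 8 * zeta 3))"
    by (intro sums_add sums_mult catalan_sums alternating_leibniz_sums odd_inverse_cubes_sums)
  moreover have "Theta1_term 0 k = - pi * ((-1) ^ k / (2 * real k + 1)\<^sup>2)
      + 2 * ((-1) ^ k * (leibniz_sum k + leibniz_sum (Suc k)) / (2 * real k + 1)\<^sup>2)
      + 2 * (1 / (2 * real k + 1) ^ 3)" for k
  proof -
    define q e L where "q = 2 * real k + 1" and "e = (-1 :: real) ^ k" and "L = leibniz_sum k"
    have "q > 0" "e * e = 1" by (simp_all add: q_def e_def power_mult_distrib[symmetric])
    \<comment> \<open>Here \<open>4 * leibniz_sum (Suc k)\<close> is written as twice the symmetric
      sum of neighbouring Leibniz sums plus \<open>2 * e / q\<close>. The signs in this last term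
      square away, and it becomes the source of \<open>zeta 3\<close>.\<close>
    have "digamma_gap (k + 0 + 1) = - e * pi + 2 * (e * (L + (L + e / q))) + 2 * ((e * e) / q)"
      by (simp add: digamma_gap_eq leibniz_sum_def q_def e_def L_def algebra_simps)
    then have "Theta1_term 0 k = (- e * pi + 2 * (e * (L + (L + e / q))) + 2 / q) / q\<^sup>2"
      unfolding Theta1_term_eq q_def[symmetric] \<open>e * e = 1\<close> by simp
    also have "\<dots> = - pi * (e / q\<^sup>2) + 2 * (e * (L + (L + e / q)) / q\<^sup>2) + 2 * (1 / q ^ 3)"
      by (simp add: add_divide_distrib diff_divide_distrib power2_eq_square power3_eq_cube mult.assoc)
    finally show ?thesis by (simp add: leibniz_sum_def q_def e_def L_def)
  qed
  ultimately have "Theta1_term 0 sums (- pi * catalan + 2 * (pi\<^sup>2 / 8 * ln 2) + 2 * (7 / 8 * zeta 3))"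
    by presburger
  then show ?thesis
    by (rule back_subst[of "\<lambda>s. Theta1_term 0 sums s"]) simp
qed

text \<open>For fixed \<open>k\<close> the numerators for \<open>n\<close> and \<open>n + 1\<close>
  are consecutive gaps, so the two terms add up to a rational function of \<open>k\<close>.\<close>

lemma Theta1_term_sums_Suc:
  assumes "Theta1_term n sums s"
  shows "Theta1_term (Suc n) sums (rational_part (Suc n) - s)"
proof -
  have "4 / ((2 * real k + 1)\<^sup>2 * (2 * real k + 1 + 2 * real (Suc n))) - Theta1_term n k = Theta1_term (Suc n) k" for k
  proof -
    have "digamma_gap (k + Suc n + 1) = 4 / (2 * real k + 1 + 2 * real (Suc n)) - digamma_gap (k + n + 1)"
      using digamma_gap_Suc[of "k + n + 1"] by (simp add: algebra_simps)
    then show ?thesis by (simp add: Theta1_term_eq diff_divide_distrib mult.commute)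
  qed
  then show ?thesis
    using sums_diff[OF rational_part_sums[of "Suc n"] assms] by simp
qed

section \<open>Two-step increments and closed forms of the series from k = 0\<close>

text \<open>Applying the recursion twice adds a difference of consecutive
  \<open>rational_part\<close> values. This one is the \<open>j\<close>-th summand of the closed
  form for odd \<open>n\<close>.\<close>

lemma rational_part_step_odd:
  assumes "j > 0"
  shows "rational_part (2 * j + 1) - rational_part (2 * j) =
    - (1 / 8) * ((4 * real j + 1) * (harm (2 * j - 1) - 2 * harm (4 * j - 1))
         / ((real j)\<^sup>2 * (2 * real j + 1)\<^sup>2))
    - 1 / ((2 * real j + 1)\<^sup>2 * (4 * real j + 1))
    - 1 / 2 * (1 / (real j * (2 * real j + 1))) * (pi\<^sup>2 / 4)"
proof -
  \<comment> \<open>Here \<open>x\<close> stands for \<open>j\<close>, \<open>X\<close> for the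
    harmonic combination and \<open>p\<close> for the square of \<open>pi\<close>. The identity is
    affine in \<open>p\<close> and \<open>X\<close>, so their coefficients and the rest are checked
    separately.\<close>
  have alg: "p / (4 * (2 * x + 1)) - (- X / 2 + 1 / (4 * x + 1)) / (2 * x + 1)\<^sup>2
      - (p / (4 * (2 * x)) - (- X / 2) / (2 * x)\<^sup>2)
    = - (1 / 8) * ((4 * x + 1) * X / (x\<^sup>2 * (2 * x + 1)\<^sup>2)) - 1 / ((2 * x + 1)\<^sup>2 * (4 * x + 1))
      - 1 / 2 * (1 / (x * (2 * x + 1))) * (p / 4)" if "x > 0" for x X p :: real
  proof -
    have nz: "x \<noteq> 0" "2 * x + 1 \<noteq> 0" "4 * x + 1 \<noteq> 0" using that by linarith+
    have "p / (4 * (2 * x + 1)) - p / (4 * (2 * x)) = - (1 / 2 * (1 / (x * (2 * x + 1))) * (p / 4))"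
      using nz by (simp add: divide_simps) (simp add: algebra_simps)
    moreover have "X / 2 / (2 * x + 1)\<^sup>2 - X / 2 / (2 * x)\<^sup>2 = - (1 / 8) * ((4 * x + 1) * X / (x\<^sup>2 * (2 * x + 1)\<^sup>2))"
      using nz by (simp add: divide_simps) (simp add: power2_eq_square algebra_simps)
    moreover have "1 / (4 * x + 1) / (2 * x + 1)\<^sup>2 = 1 / ((2 * x + 1)\<^sup>2 * (4 * x + 1))"
      by (simp add: mult.commute)
    ultimately show ?thesis by (simp add: diff_divide_distrib add_divide_distrib mult_ac)
  qed
  have o1: "odd_harm (2 * j + 1) = - (harm (2 * j - 1) - 2 * harm (4 * j - 1)) / 2 + 1 / (4 * real j + 1)"
    using odd_harm_Suc[of "2 * j"] by (simp add: odd_harm_even assms)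
  have r: "real (2 * j) = 2 * real j" "real (2 * j + 1) = 2 * real j + 1" by simp_all
  show ?thesis
    unfolding rational_part_def o1 odd_harm_even[OF assms] r using assms by (intro alg) simp
qed

text \<open>The counterpart for even \<open>n\<close>. The odd harmonic sums now exceed
  \<open>odd_harm (2 * j)\<close> by one and two terms; these extra terms combine to the fraction
  with the cubic numerator.\<close>

lemma rational_part_step_even:
  assumes "j > 0"
  shows "rational_part (2 * j + 2) - rational_part (2 * j + 1) =
    - (1 / 8) * ((4 * real j + 3) * (harm (2 * j - 1) - 2 * harm (4 * j - 1))
         / ((real j + 1)\<^sup>2 * (2 * real j + 1)\<^sup>2))
    - (4 * real j ^ 3 + real j ^ 2 - 4 * real j - 2)
              / ((real j + 1) ^ 2 * (2 * real j + 1) ^ 2 * (4 * real j + 3) * (4 * real j + 1))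
    - 1 / 2 * (1 / ((real j + 1) * (2 * real j + 1))) * (pi\<^sup>2 / 4)"
proof -
  have alg: "p / (4 * (2 * x + 2)) - (- X / 2 + 1 / (4 * x + 1) + 1 / (4 * x + 3)) / (2 * x + 2)\<^sup>2
      - (p / (4 * (2 * x + 1)) - (- X / 2 + 1 / (4 * x + 1)) / (2 * x + 1)\<^sup>2)
    = - (1 / 8) * ((4 * x + 3) * X / ((x + 1)\<^sup>2 * (2 * x + 1)\<^sup>2))
      - (4 * x ^ 3 + x ^ 2 - 4 * x - 2) / ((x + 1) ^ 2 * (2 * x + 1) ^ 2 * (4 * x + 3) * (4 * x + 1))
      - 1 / 2 * (1 / ((x + 1) * (2 * x + 1))) * (p / 4)" if "x > 0" for x X p :: real
  proof -
    have nz: "x + 1 \<noteq> 0" "2 * x + 1 \<noteq> 0" "4 * x + 1 \<noteq> 0" "4 * x + 3 \<noteq> 0" using that by linarith+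
    have two: "2 * x + 2 = 2 * (x + 1)" by simp
    have "p / (4 * (2 * x + 2)) - p / (4 * (2 * x + 1)) = - (1 / 2 * (1 / ((x + 1) * (2 * x + 1))) * (p / 4))"
      unfolding two using nz by (simp add: divide_simps) (simp add: algebra_simps)
    moreover have "X / 2 / (2 * x + 2)\<^sup>2 - X / 2 / (2 * x + 1)\<^sup>2 = - (1 / 8) * ((4 * x + 3) * X / ((x + 1)\<^sup>2 * (2 * x + 1)\<^sup>2))"
      unfolding two using nz by (simp add: divide_simps) (simp add: power2_eq_square algebra_simps)
    moreover have "(1 / (4 * x + 1) + 1 / (4 * x + 3)) / (2 * x + 2)\<^sup>2 - 1 / (4 * x + 1) / (2 * x + 1)\<^sup>2
        = (4 * x ^ 3 + x ^ 2 - 4 * x - 2) / ((x + 1) ^ 2 * (2 * x + 1) ^ 2 * (4 * x + 3) * (4 * x + 1))"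
      unfolding two using nz by (simp add: divide_simps) (simp add: power2_eq_square power3_eq_cube algebra_simps)
    ultimately show ?thesis by (simp add: diff_divide_distrib add_divide_distrib mult_ac)
  qed
  have o1: "odd_harm (2 * j + 1) = - (harm (2 * j - 1) - 2 * harm (4 * j - 1)) / 2 + 1 / (4 * real j + 1)"
    using odd_harm_Suc[of "2 * j"] by (simp add: odd_harm_even assms)
  have o2: "odd_harm (2 * j + 2) = odd_harm (2 * j + 1) + 1 / (4 * real j + 3)"
    using odd_harm_Suc[of "2 * j + 1"] by (simp add: algebra_simps)
  have r: "real (2 * j + 1) = 2 * real j + 1" "real (2 * j + 2) = 2 * real j + 2" by simp_all
  show ?thesis
    unfolding rational_part_def o2 o1 r using assms by (intro alg) simp
qed

text \<open>Induction in steps of two from \<open>n = 1\<close>, which is one recursion step after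
  \<open>n = 0\<close>; the constant \<open>- 1\<close> comes from \<open>rational_part 1\<close>.
  The constants differ from the final formula because the \<open>k = 0\<close> term is still
  included.\<close>

lemma Theta1_term_sums_odd:
  "Theta1_term (2 * J + 1) sums
    (- 1
     - 1 / 8 * (\<Sum>j = 1..J. (4 * real j + 1) * (harm (2 * j - 1) - 2 * harm (4 * j - 1))
          / (real j ^ 2 * (2 * real j + 1) ^ 2))
     - (\<Sum>j = 1..J. 1 / ((2 * real j + 1) ^ 2 * (4 * real j + 1)))
     + pi * catalan
     + (1 - ln 2 - 1 / 2 * (\<Sum>j = 1..J. 1 / (real j * (2 * real j + 1)))) * (pi\<^sup>2 / 4)
     - 7 / 4 * zeta 3)"
proof (induction J)
  case 0
  have r: "rational_part (Suc 0) = pi\<^sup>2 / 4 - 1" by (simp add: rational_part_def odd_harm_def)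
  have "Theta1_term (2 * 0 + 1) sums (rational_part (Suc 0) - (- pi * catalan + pi\<^sup>2 / 4 * ln 2 + 7 / 4 * zeta 3))"
    using Theta1_term_sums_Suc[OF Theta1_term_sums_0] by simp
  then show ?case
    unfolding r by (rule back_subst[of "\<lambda>s. Theta1_term (2 * 0 + 1) sums s"]) (simp add: field_simps)
next
  case (Suc J)
  \<comment> \<open>The sums are abstracted to variables, so that absorbing the new summands is pure
    regrouping.\<close>
  have collect: "(- 1 - 1 / 8 * S - T + C + (L - 1 / 2 * U) * P - Z) + (- (1 / 8) * x - y - 1 / 2 * z * P)
      = - 1 - 1 / 8 * (S + x) - (T + y) + C + (L - 1 / 2 * (U + z)) * P - Z"
    for S T C L U P Z x y z :: real
    by (simp add: algebra_simps add_divide_distrib)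
  have split: "(\<Sum>j = 1..Suc J. f j) = (\<Sum>j = 1..J. f j) + f (Suc J)" for f :: "nat \<Rightarrow> real"
    by simp
  have "Theta1_term (2 * Suc J + 1) sums (rational_part (2 * Suc J + 1) - (rational_part (2 * Suc J) - s))"
    if "Theta1_term (2 * J + 1) sums s" for s
    using Theta1_term_sums_Suc[OF Theta1_term_sums_Suc[OF that]] by simp
  note this[OF Suc]
  moreover have "rational_part (2 * Suc J + 1) - (rational_part (2 * Suc J) - s)
      = s + (rational_part (2 * Suc J + 1) - rational_part (2 * Suc J))" for s
    by simp
  ultimately show ?case
    unfolding split by (simp only: rational_part_step_odd[OF zero_less_Suc] collect)
qed

text \<open>The induction starts at \<open>n = 2\<close>, one recursion step after
  \<open>n = 1\<close>: the constant is \<open>- 1/3 + 1\<close>, with \<open>- 1/3\<close> from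
  \<open>rational_part 2\<close>.\<close>

lemma Theta1_term_sums_even:
  "Theta1_term (2 * J + 2) sums
    (2 / 3
     - 1 / 8 * (\<Sum>j = 1..J. (4 * real j + 3) * (harm (2 * j - 1) - 2 * harm (4 * j - 1))
          / ((real j + 1) ^ 2 * (2 * real j + 1) ^ 2))
     - (\<Sum>j = 1..J. (4 * real j ^ 3 + real j ^ 2 - 4 * real j - 2)
          / ((real j + 1) ^ 2 * (2 * real j + 1) ^ 2 * (4 * real j + 3) * (4 * real j + 1)))
     - pi * catalan
     + (ln 2 - 1 / 2 - 1 / 2 * (\<Sum>j = 1..J. 1 / ((real j + 1) * (2 * real j + 1)))) * (pi\<^sup>2 / 4)
     + 7 / 4 * zeta 3)"
proof (induction J)
  case 0
  have r: "rational_part (Suc (2 * 0 + 1)) = pi\<^sup>2 / 8 - 1 / 3"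
    by (simp add: rational_part_def odd_harm_def field_simps)
  have n: "2 * 0 + 2 = Suc (2 * 0 + 1)" by simp
  show ?case
    unfolding n
    by (rule back_subst[of "\<lambda>s. Theta1_term (Suc (2 * 0 + 1)) sums s",
          OF Theta1_term_sums_Suc[OF Theta1_term_sums_odd[of 0], unfolded r]])
      (simp add: field_simps)
next
  case (Suc J)
  have collect: "(2 / 3 - 1 / 8 * S - T - C + (L - 1 / 2 * U) * P + Z) + (- (1 / 8) * x - y - 1 / 2 * z * P)
      = 2 / 3 - 1 / 8 * (S + x) - (T + y) - C + (L - 1 / 2 * (U + z)) * P + Z"
    for S T C L U P Z x y z :: real
    by (simp add: algebra_simps add_divide_distrib)
  have split: "(\<Sum>j = 1..Suc J. f j) = (\<Sum>j = 1..J. f j) + f (Suc J)" for f :: "nat \<Rightarrow> real"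
    by simp
  have "Theta1_term (2 * Suc J + 2) sums (rational_part (2 * Suc J + 2) - (rational_part (2 * Suc J + 1) - s))"
    if "Theta1_term (2 * J + 2) sums s" for s
    using Theta1_term_sums_Suc[OF Theta1_term_sums_Suc[OF that]] by simp
  note this[OF Suc]
  moreover have "rational_part (2 * Suc J + 2) - (rational_part (2 * Suc J + 1) - s)
      = s + (rational_part (2 * Suc J + 2) - rational_part (2 * Suc J + 1))" for s
    by simp
  ultimately show ?case
    unfolding split by (simp only: rational_part_step_even[OF zero_less_Suc] collect)
qed

section \<open>Removing the term k = 0\<close>

text \<open>The denominator is 1 at \<open>k = 0\<close>, so this is a single gap. The leading 1 of
  the Leibniz sum gives the \<open>- 4\<close>; the rest is the alternating sum in the
  theorem.\<close>

lemma Theta1_term_0: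
  "Theta1_term n 0 = (-1) ^ Suc n * (pi - 4 - 4 * (\<Sum>j = 1..n. (-1) ^ j / (2 * real j + 1)))"
proof -
  have "leibniz_sum (Suc n) = 1 + (\<Sum>j = 1..n. (-1) ^ j / (2 * real j + 1))"
    unfolding leibniz_sum_def by (subst sum.lessThan_Suc_shift) (simp add: sum.atLeast1_atMost_eq)
  then show ?thesis by (simp add: Theta1_term_eq digamma_gap_eq)
qed

lemma Theta1_eq:
  assumes "Theta1_term n sums s"
  shows "Theta1 n = s - Theta1_term n 0"
proof -
  have "(\<lambda>k. Theta1_term n (Suc k)) sums (s - Theta1_term n 0)"
    using assms by (simp add: sums_Suc_iff)
  then show ?thesis unfolding Theta1_def by (rule sums_unique[symmetric])
qed

lemma summable_Theta1_term: "summable (Theta1_term n)"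
  by (induction n) (use Theta1_term_sums_0 Theta1_term_sums_Suc in \<open>auto simp: summable_def\<close>)

lemma Theta1_0: "Theta1 0 = - 4 + (1 - catalan) * pi + pi ^ 2 / 4 * ln 2 + 7 / 4 * zeta 3"
  using Theta1_eq[OF Theta1_term_sums_0] by (simp add: Theta1_term_0 algebra_simps)

text \<open>Subtracting the \<open>k = 0\<close> term changes the constant \<open>- 1\<close> to 3
  and \<open>pi * catalan\<close> to \<open>- (1 - catalan) * pi\<close>.\<close>

lemma Theta1_odd:
  assumes "odd n"
  shows "Theta1 n =
        3
        - 1 / 8 * (\<Sum>j = 1..(n - 1) div 2.
            (4 * real j + 1) * (harm (2 * j - 1) - 2 * harm (4 * j - 1))
              / (real j ^ 2 * (2 * real j + 1) ^ 2))
        - (\<Sum>j = 1..(n - 1) div 2. 1 / ((2 * real j + 1) ^ 2 * (4 * real j + 1)))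
        + 4 * (\<Sum>j = 1..n. (-1) ^ j / (2 * real j + 1))
        - (1 - catalan) * pi
        + (1 - ln 2 - 1 / 2 * (\<Sum>j = 1..(n - 1) div 2. 1 / (real j * (2 * real j + 1))))
            * (pi ^ 2 / 4)
        - 7 / 4 * zeta 3"
proof -
  from assms obtain J where n: "n = 2 * J + 1" by (rule oddE)
  then have J: "(n - 1) div 2 = J" by simp
  have collect: "(- 1 - A - B + pi * c + d - z) - (pi - 4 - 4 * S)
      = 3 - A - B + 4 * S - (1 - c) * pi + d - z" for A B c d z S :: real
    by (simp add: algebra_simps)
  have "Theta1_term n 0 = pi - 4 - 4 * (\<Sum>j = 1..n. (-1) ^ j / (2 * real j + 1))"
    using assms by (simp add: Theta1_term_0)
  then show ?thesis
    unfolding J Theta1_eq[OF Theta1_term_sums_odd[of J, folded n]] by (simp only: collect)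
qed

lemma Theta1_even:
  assumes "even n" "n \<ge> 2"
  shows "Theta1 n =
        - (10 / 3)
        - 1 / 8 * (\<Sum>j = 1..(n - 2) div 2.
            (4 * real j + 3) * (harm (2 * j - 1) - 2 * harm (4 * j - 1))
              / ((real j + 1) ^ 2 * (2 * real j + 1) ^ 2))
        - (\<Sum>j = 1..(n - 2) div 2.
            (4 * real j ^ 3 + real j ^ 2 - 4 * real j - 2)
              / ((real j + 1) ^ 2 * (2 * real j + 1) ^ 2 * (4 * real j + 3) * (4 * real j + 1)))
        - 4 * (\<Sum>j = 1..n. (-1) ^ j / (2 * real j + 1))
        + (1 - catalan) * pi
        + (ln 2 - 1 / 2 - 1 / 2 * (\<Sum>j = 1..(n - 2) div 2. 1 / ((real j + 1) * (2 * real j + 1))))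
            * (pi ^ 2 / 4)
        + 7 / 4 * zeta 3"
proof -
  define J where "J = (n - 2) div 2"
  then have n: "n = 2 * J + 2" using assms by auto
  have collect: "(2 / 3 - A - B - pi * c + d + z) - (- pi + 4 + 4 * S)
      = - (10 / 3) - A - B - 4 * S + (1 - c) * pi + d + z" for A B c d z S :: real
    by (simp add: algebra_simps)
  have "Theta1_term n 0 = - pi + 4 + 4 * (\<Sum>j = 1..n. (-1) ^ j / (2 * real j + 1))"
    using assms by (simp add: Theta1_term_0)
  then show ?thesis
    unfolding J_def[symmetric] Theta1_eq[OF Theta1_term_sums_even[of J, folded n]] by (simp only: collect)
qed

theorem theorem1:
  fixes n :: nat
  shows "summable (\<lambda>k. Theta1_term n (Suc k)) \<and>
    (n = 0 \<longrightarrow>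
      Theta1 n = - 4 + (1 - catalan) * pi + pi ^ 2 / 4 * ln 2 + 7 / 4 * zeta 3) \<and>
    (n = 1 \<longrightarrow>
      Theta1 n = 5 / 3 - (1 - catalan) * pi + (1 - ln 2) * (pi ^ 2 / 4) - 7 / 4 * zeta 3) \<and>
    (n = 2 \<longrightarrow>
      Theta1 n = - (14 / 5) + (1 - catalan) * pi + (ln 2 - 1 / 2) * (pi ^ 2 / 4) + 7 / 4 * zeta 3) \<and>
    (odd n \<and> n \<noteq> 1 \<longrightarrow>
      Theta1 n =
        3
        - 1 / 8 * (\<Sum>j = 1..(n - 1) div 2.
            (4 * real j + 1) * (harm (2 * j - 1) - 2 * harm (4 * j - 1))
              / (real j ^ 2 * (2 * real j + 1) ^ 2))
        - (\<Sum>j = 1..(n - 1) div 2. 1 / ((2 * real j + 1) ^ 2 * (4 * real j + 1)))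
        + 4 * (\<Sum>j = 1..n. (-1) ^ j / (2 * real j + 1))
        - (1 - catalan) * pi
        + (1 - ln 2 - 1 / 2 * (\<Sum>j = 1..(n - 1) div 2. 1 / (real j * (2 * real j + 1))))
            * (pi ^ 2 / 4)
        - 7 / 4 * zeta 3) \<and>
    (even n \<and> n \<ge> 4 \<longrightarrow>
      Theta1 n =
        - (10 / 3)
        - 1 / 8 * (\<Sum>j = 1..(n - 2) div 2.
            (4 * real j + 3) * (harm (2 * j - 1) - 2 * harm (4 * j - 1))
              / ((real j + 1) ^ 2 * (2 * real j + 1) ^ 2))
        - (\<Sum>j = 1..(n - 2) div 2.
            (4 * real j ^ 3 + real j ^ 2 - 4 * real j - 2)
              / ((real j + 1) ^ 2 * (2 * real j + 1) ^ 2 * (4 * real j + 3) * (4 * real j + 1)))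
        - 4 * (\<Sum>j = 1..n. (-1) ^ j / (2 * real j + 1))
        + (1 - catalan) * pi
        + (ln 2 - 1 / 2 - 1 / 2 * (\<Sum>j = 1..(n - 2) div 2. 1 / ((real j + 1) * (2 * real j + 1))))
            * (pi ^ 2 / 4)
        + 7 / 4 * zeta 3)"
proof (intro conjI impI)
  show "summable (\<lambda>k. Theta1_term n (Suc k))"
    using summable_Theta1_term by (simp add: summable_Suc_iff)
next
  assume n: "n = 1"
  show "Theta1 n = 5 / 3 - (1 - catalan) * pi + (1 - ln 2) * (pi ^ 2 / 4) - 7 / 4 * zeta 3"
    \<comment> \<open>The sums up to 0 are empty, and the alternating sum is \<open>- 1/3\<close>,
      so the constant is \<open>3 - 4/3\<close>.\<close>
    using Theta1_odd[of 1] n by simp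
next
  assume n: "n = 2"
  \<comment> \<open>With the other sums empty, the constant becomes
    \<open>- 10/3 + 8/15 = - 14/5\<close>.\<close>
  have "(\<Sum>j = 1..2. (-1) ^ j / (2 * real j + 1)) = - 2 / 15"
    by (simp add: numeral_2_eq_2)
  then show "Theta1 n = - (14 / 5) + (1 - catalan) * pi + (ln 2 - 1 / 2) * (pi ^ 2 / 4) + 7 / 4 * zeta 3"
    using Theta1_even[of 2] n by simp
qed (simp only: Theta1_0, rule Theta1_odd, simp, rule Theta1_even, simp_all)

end
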